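(* Let $\Omega\subset\mathbb{R}^n$ be a bounded open set with $0\in\partial\Omega$, let $r_0>0$, and let $\psi$ be a non-negative, non-decreasing function on $[0,r_0]$ with $\psi(r_0)<r_0$ and $$I(\psi):=\int_0^{r_0}\frac{\psi(r)\,dr}{r^2}<\infty .$$ Let $Q:=\{x=(x',x_n)\in\mathbb{R}^n:\ |x'|<r_0,\ 0<x_n-\psi(|x'|)<r_0\}$, $-Q:=\{x\in\mathbb{R}^n:\ -x\in Q\}$, and suppose that $-Q\subset\mathbb{R}^n\setminus\Omega$ (exterior $Q$-condition at $0$). Let $Lu:=\sum_{i,j}a_{ij}D_{ij}u$ be a uniformly elliptic operator with bounded measurable coefficients. Then for any function $u\in C^2(\Omega)\cap C(\overline{\Omega})$ satisfying $u>0$ and $Lu\ge0$ in $\Omega$, and $u=0$ on $(\partial\Omega)\cap B_{r_0}(0)$, we have $$\sup_{\Omega\cap B_{r_0}(0)}\frac{u(x)}{|x|}<\infty .$$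
   Context: Points of $\mathbb{R}^n$ are written $x=(x',x_n)$ with $x'=(x_1,\dots,x_{n-1})\in\mathbb{R}^{n-1}$. $B_r(x_0)=\{x\in\mathbb{R}^n:|x-x_0|<r\}$. $D_iu=\partial u/\partial x_i$, $D_{ij}u=D_iD_ju$. The coefficients of $L$ satisfy $a_{ij}=a_{ji}\in L^\infty(\mathbb{R}^n)$ and the uniform ellipticity condition $\nu|\xi|^2\le\sum_{i,j}a_{ij}\xi_i\xi_j\le\nu^{-1}|\xi|^2$ for all $\xi\in\mathbb{R}^n$, with a constant $\nu\in(0,1]$; no continuity of $a_{ij}$ is assumed, and $L$ has no lower order terms. *)

theory Defs
  imports "HOL-Analysis.Analysis"
begin

text \<open>
  The space is \<^typ>\<open>real ^ 'n\<close> with an arbitrary finite index type, so the dimension is any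
  \<open>n \<ge> 1\<close>. The index type carries no order; the index playing the role of the last coordinate
  \<open>x\<^sub>n\<close> is passed explicitly as \<open>k\<close>, and \<open>x'\<close> collects the other coordinates.
\<close>

definition norm_prime :: "'n::finite \<Rightarrow> real ^ 'n \<Rightarrow> real"
  where "norm_prime k x = L2_set (\<lambda>i. x $ i) (UNIV - {k})"

definition Q_region :: "'n::finite \<Rightarrow> real \<Rightarrow> (real \<Rightarrow> real) \<Rightarrow> (real ^ 'n) set"
  where "Q_region k r0 \<psi> =
    {x. norm_prime k x < r0 \<and> 0 < x $ k - \<psi> (norm_prime k x) \<and> x $ k - \<psi> (norm_prime k x) < r0}"

text \<open>On sets, unary minus is the complement, hence the explicit reflection in the origin.\<close>

definition exterior_Q_condition :: "'n::finite \<Rightarrow> real \<Rightarrow> (real \<Rightarrow> real) \<Rightarrow> (real ^ 'n) set \<Rightarrow> bool"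
  where "exterior_Q_condition k r0 \<psi> \<Omega> \<longleftrightarrow> {x. - x \<in> Q_region k r0 \<psi>} \<subseteq> UNIV - \<Omega>"

definition dini_integral :: "real \<Rightarrow> (real \<Rightarrow> real) \<Rightarrow> ennreal"
  where "dini_integral r0 \<psi> = (\<integral>\<^sup>+ r \<in> {0<..r0}. ennreal (\<psi> r / r\<^sup>2) \<partial>lborel)"

definition partial_D :: "'n::finite \<Rightarrow> (real ^ 'n \<Rightarrow> real) \<Rightarrow> real ^ 'n \<Rightarrow> real"
  where "partial_D i u x = deriv (\<lambda>t. u (x + t *\<^sub>R axis i 1)) 0"

text \<open>
  \<^const>\<open>deriv\<close> is a choice operator and total, so the existence of the partial derivatives
  has to be demanded separately.
\<close>

definition C1_on :: "(real ^ 'n::finite) set \<Rightarrow> (real ^ 'n \<Rightarrow> real) \<Rightarrow> bool"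
  where "C1_on \<Omega> u \<longleftrightarrow> continuous_on \<Omega> u \<and>
    (\<forall>i. (\<forall>x\<in>\<Omega>. (\<lambda>t. u (x + t *\<^sub>R axis i 1)) differentiable at 0) \<and>
         continuous_on \<Omega> (partial_D i u))"

definition C2_on :: "(real ^ 'n::finite) set \<Rightarrow> (real ^ 'n \<Rightarrow> real) \<Rightarrow> bool"
  where "C2_on \<Omega> u \<longleftrightarrow> C1_on \<Omega> u \<and> (\<forall>i. C1_on \<Omega> (partial_D i u))"

definition L_infinity :: "(real ^ 'n::finite \<Rightarrow> real) \<Rightarrow> bool"
  where "L_infinity f \<longleftrightarrow>
    f \<in> borel_measurable lebesgue \<and> (\<exists>C. AE x in lebesgue. \<bar>f x\<bar> \<le> C)"

text \<open>
  Coefficients in \<open>L\<^sup>\<infinity>\<close> are determined only almost everywhere, so the pointwise conditions on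
  them are imposed almost everywhere.
\<close>

definition uniformly_elliptic :: "real \<Rightarrow> ('n::finite \<Rightarrow> 'n \<Rightarrow> real ^ 'n \<Rightarrow> real) \<Rightarrow> bool"
  where "uniformly_elliptic \<nu> a \<longleftrightarrow>
    0 < \<nu> \<and> \<nu> \<le> 1 \<and>
    (\<forall>i j. L_infinity (a i j)) \<and>
    (\<forall>i j. AE x in lebesgue. a i j x = a j i x) \<and>
    (AE x in lebesgue. \<forall>\<xi> :: real ^ 'n.
        \<nu> * (norm \<xi>)\<^sup>2 \<le> (\<Sum>i\<in>UNIV. \<Sum>j\<in>UNIV. a i j x * \<xi> $ i * \<xi> $ j) \<and>
        (\<Sum>i\<in>UNIV. \<Sum>j\<in>UNIV. a i j x * \<xi> $ i * \<xi> $ j) \<le> inverse \<nu> * (norm \<xi>)\<^sup>2)"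

definition L_op :: "('n::finite \<Rightarrow> 'n \<Rightarrow> real ^ 'n \<Rightarrow> real) \<Rightarrow> (real ^ 'n \<Rightarrow> real) \<Rightarrow> real ^ 'n \<Rightarrow> real"
  where "L_op a u x = (\<Sum>i\<in>UNIV. \<Sum>j\<in>UNIV. a i j x * partial_D i (partial_D j u) x)"

end

theory Submission
  imports Defs
begin

text \<open>
  Write \<open>R\<^sub>j = r0 / 2\<^sup>j\<close> and \<open>\<psi>\<^sub>j = \<psi> (R\<^sub>j)\<close>. Since \<open>\<psi>\<close> is monotone, the exterior condition puts
  \<open>\<Omega> \<inter> B(R\<^sub>j)\<close> above the hyperplane \<open>x\<^sub>n = - \<psi>\<^sub>j\<close>. The proof compares \<open>u\<close> with multiples of the height
  above this hyperplane, one dyadic scale after the other: \<open>u \<le> m\<^sub>j (x\<^sub>n + \<psi>\<^sub>j)\<close> in \<open>\<Omega> \<inter> B(R\<^sub>j\<^sub>+\<^sub>1)\<close>, for suitable slopes \<open>m\<^sub>j\<close>.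

  Passing to the next scale raises the hyperplane from \<open>x\<^sub>n = - \<psi>\<^sub>j\<close> to \<open>x\<^sub>n = - \<psi>\<^sub>j\<^sub>+\<^sub>1\<close>, so
  that \<open>u\<close> exceeds \<open>m\<^sub>j (x\<^sub>n + \<psi>\<^sub>j\<^sub>+\<^sub>1)\<close> by at most \<open>m\<^sub>j \<psi>\<^sub>j\<close>. Affine functions solve every equation without
  lower order terms, so this excess may be treated as a bounded subsolution in a half space that is
  non-positive on the nearby boundary; it is therefore at most a constant times
  \<open>m\<^sub>j \<psi>\<^sub>j / R\<^sub>j\<close> times the height, in the ball of half the radius
  (\<open>linear_bound_improves_on_half_ball\<close>). Hence \<open>m\<^sub>j\<^sub>+\<^sub>1 = (1 + C \<psi>\<^sub>j / R\<^sub>j) m\<^sub>j\<close>. The point is that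
  the leading term is carried over with the factor 1, so the losses only accumulate in the product of
  the \<open>1 + C \<psi>\<^sub>j / R\<^sub>j\<close>. This product is bounded because \<open>\<Sum> \<psi>\<^sub>j / R\<^sub>j\<close> is controlled by the Dini integral
  (\<open>dyadic_sum_bounded_of_dini\<close>). With bounded slopes, the estimate at the scale of \<open>|x|\<close> gives
  \<open>u(x) \<le> C |x|\<close>.

  The half-space estimate is a comparison with a quadratic barrier, and the comparison is
  pointwise: at a maximum of the difference the Hessian of \<open>u\<close> is below that of the barrier. The equation
  holds only almost everywhere and may fail at the point of maximum, but the barrier is a
  strict supersolution for all operators with ellipticity constant \<open>\<nu>\<close>, with room to spare. By continuity of
  the second derivatives the contradiction is reached at a nearby point where the equation does hold
  (\<open>subsolution_hessian_not_below\<close>).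
\<close>

section \<open>Quadratic forms\<close>

definition quad_form :: "('n::finite \<Rightarrow> 'n \<Rightarrow> real) \<Rightarrow> real ^ 'n \<Rightarrow> real"
  where "quad_form a \<xi> = (\<Sum>i\<in>UNIV. \<Sum>j\<in>UNIV. a i j * \<xi> $ i * \<xi> $ j)"

lemma quad_form_axis: "quad_form a (axis k 1) = a k k"
proof -
  have "a i j * axis k 1 $ i * axis k 1 $ j = (if j = k then (if i = k then a i j else 0) else 0)" for i j
    by (simp add: axis_def)
  then show ?thesis by (simp add: quad_form_def)
qed

lemma quad_form_add_axis:
  fixes a :: "'n::finite \<Rightarrow> 'n \<Rightarrow> real" and \<xi> :: "real ^ 'n"
  assumes sym: "\<And>i j. a i j = a j i"
  shows "quad_form a (\<xi> + s *\<^sub>R axis k 1)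
    = quad_form a \<xi> + 2 * s * (\<Sum>i\<in>UNIV. a i k * \<xi> $ i) + s\<^sup>2 * a k k"
proof -
  have e: "axis k (1::real) $ i = (if i = k then 1 else 0)" for i
    by (simp add: axis_def)
  have "a i j * (\<xi> + s *\<^sub>R axis k 1) $ i * (\<xi> + s *\<^sub>R axis k 1) $ j
     = a i j * \<xi> $ i * \<xi> $ j + (if j = k then s * (a i j * \<xi> $ i) else 0)
       + (if i = k then s * (a j i * \<xi> $ j) else 0) + (if j = k then (if i = k then s\<^sup>2 * a i j else 0) else 0)" for i j
    using sym[of i j] by (auto simp: e algebra_simps power2_eq_square)
  then have "quad_form a (\<xi> + s *\<^sub>R axis k 1) = (\<Sum>i\<in>UNIV. \<Sum>j\<in>UNIV. a i j * \<xi> $ i * \<xi> $ j)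
      + (\<Sum>i\<in>UNIV. \<Sum>j\<in>UNIV. (if j = k then s * (a i j * \<xi> $ i) else 0))
      + (\<Sum>i\<in>UNIV. \<Sum>j\<in>UNIV. (if i = k then s * (a j i * \<xi> $ j) else 0))
      + (\<Sum>i\<in>UNIV. \<Sum>j\<in>UNIV. (if j = k then (if i = k then s\<^sup>2 * a i j else 0) else 0))"
    by (simp only: quad_form_def sum.distrib)
  moreover have "(\<Sum>i\<in>UNIV. \<Sum>j\<in>UNIV. (if i = k then s * (a j i * \<xi> $ j) else 0))
     = (\<Sum>j\<in>UNIV. s * (a j k * \<xi> $ j))"
    by (subst sum.swap) simp
  ultimately show ?thesis
    by (simp add: quad_form_def sum_distrib_left mult.assoc)
qed

text \<open>
  A positive semidefinite \<open>a\<close> is a sum of squares \<open>v v\<^sup>T\<close>, and each of them pairs with \<open>M\<close> to the value of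
  the form \<open>M\<close> at \<open>v\<close>. The squares are split off one index at a time by Schur complements,
  which makes the proof an induction over semidefinite matrices supported on ever smaller sets of
  indices. It is used with the coefficients of the operator as \<open>a\<close> and with an upper
  bound for the Hessian of \<open>u\<close> minus this Hessian as \<open>M\<close>.
\<close>
lemma psd_pairing_nonneg:
  fixes a M :: "'n::finite \<Rightarrow> 'n \<Rightarrow> real"
  assumes "\<And>i j. a i j = a j i" and "\<And>\<xi>. 0 \<le> quad_form a \<xi>" and M: "\<And>\<xi>. 0 \<le> quad_form M \<xi>"
  shows "0 \<le> (\<Sum>i\<in>UNIV. \<Sum>j\<in>UNIV. a i j * M i j)"
proof -
  have "0 \<le> (\<Sum>i\<in>UNIV. \<Sum>j\<in>UNIV. a i j * M i j)"
    if "finite S" "\<And>i j. a i j = a j i" "\<And>\<xi>. 0 \<le> quad_form a \<xi>" "\<And>i j. i \<notin> S \<Longrightarrow> a i j = 0"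
    for S :: "'n set" and a :: "'n \<Rightarrow> 'n \<Rightarrow> real"
    using that
  proof (induction S arbitrary: a rule: finite_induct)
    case empty
    then show ?case by simp
  next
    case (insert k S)
    note sym = insert.prems(1) and psd = insert.prems(2) and supp = insert.prems(3)
    have akk: "0 \<le> a k k" using psd[of "axis k 1"] by (simp add: quad_form_axis)
    show ?case
    proof (cases "a k k = 0")
      case True
      \<comment> \<open>A semidefinite form that vanishes at a basis vector has a zero row there: otherwise it would
        be negative at a suitable point of a line in that direction.\<close>
      have "a k j = 0" for j
      proof (rule ccontr)
        assume nz: "a k j \<noteq> 0"
        define s where "s = - (a j j + 1) / (2 * a k j)"
        have "(\<Sum>i\<in>UNIV. a i k * axis j 1 $ i) = (\<Sum>i\<in>UNIV. if i = j then a i k else 0)"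
          by (intro sum.cong) (auto simp: axis_def)
        then have "(\<Sum>i\<in>UNIV. a i k * axis j 1 $ i) = a k j"
          using sym[of j k] by simp
        then have "quad_form a (axis j 1 + s *\<^sub>R axis k 1) = a j j + 2 * s * a k j"
          by (simp add: quad_form_add_axis[OF sym] quad_form_axis True)
        also have "\<dots> = - 1" using nz by (simp add: s_def field_simps)
        finally show False using psd[of "axis j 1 + s *\<^sub>R axis k 1"] by simp
      qed
      then have "a i j = 0" if "i \<notin> S" for i j
        using supp[of i j] that by (cases "i = k") auto
      then show ?thesis using insert.IH[of a] sym psd by blast
    next
      case False
      with akk have pos: "0 < a k k" by simp
      \<comment> \<open>The Schur complement of the pivot. Completing the square shows that it is again semidefinite.\<close>
      define a' where "a' i j = a i j - a i k * a j k / a k k" for i j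
      define v :: "real ^ 'n" where "v = (\<chi> i. a i k)"
      have "0 \<le> quad_form a' \<xi>" for \<xi>
      proof -
        define b where "b = (\<Sum>i\<in>UNIV. a i k * \<xi> $ i)"
        have "quad_form a' \<xi> = (\<Sum>i\<in>UNIV. \<Sum>j\<in>UNIV. a i j * \<xi> $ i * \<xi> $ j - a i k * \<xi> $ i * (a j k * \<xi> $ j) / a k k)"
          by (simp add: quad_form_def a'_def algebra_simps)
        also have "\<dots> = quad_form a \<xi> - b * b / a k k"
          by (simp add: quad_form_def b_def sum_subtractf sum_product sum_divide_distrib)
        also have "\<dots> = quad_form a (\<xi> + (- b / a k k) *\<^sub>R axis k 1)"
          unfolding quad_form_add_axis[OF sym] b_def[symmetric]
          using pos by (simp add: field_simps power2_eq_square)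
        finally show ?thesis using psd by simp
      qed
      moreover have "a' i j = 0" if "i \<notin> S" for i j
        using supp[of i j] supp[of i k] that pos sym[of j k] by (cases "i = k") (auto simp: a'_def)
      moreover have "a' i j = a' j i" for i j using sym[of i j] by (simp add: a'_def)
      ultimately have "0 \<le> (\<Sum>i\<in>UNIV. \<Sum>j\<in>UNIV. a' i j * M i j)"
        using insert.IH[of a'] by blast
      moreover have "a i j * M i j = a' i j * M i j + M i j * v $ i * v $ j / a k k" for i j
        by (simp add: a'_def v_def algebra_simps)
      then have "(\<Sum>i\<in>UNIV. \<Sum>j\<in>UNIV. a i j * M i j)
        = (\<Sum>i\<in>UNIV. \<Sum>j\<in>UNIV. a' i j * M i j) + quad_form M v / a k k"
        by (simp add: quad_form_def sum.distrib sum_divide_distrib)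
      ultimately show ?thesis using M[of v] pos by simp
    qed
  qed
  from this[of UNIV a] assms show ?thesis by auto
qed

lemma quad_form_diff: "quad_form (\<lambda>i j. a i j - b i j) \<xi> = quad_form a \<xi> - quad_form b \<xi>"
  by (simp add: quad_form_def algebra_simps sum_subtractf)

lemma quad_form_diagonal:
  "quad_form (\<lambda>i j. if i = j then c i else 0) \<xi> = (\<Sum>i\<in>UNIV. c i * (\<xi> $ i)\<^sup>2)"
proof -
  have "(if i = j then c i else 0) * \<xi> $ i * \<xi> $ j = (if j = i then c i * (\<xi> $ i)\<^sup>2 else 0)" for i j
    by (simp add: power2_eq_square)
  then show ?thesis by (simp add: quad_form_def)
qed

lemma norm_power2_cart: "(norm (\<xi> :: real ^ 'n::finite))\<^sup>2 = (\<Sum>i\<in>UNIV. (\<xi> $ i)\<^sup>2)"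
  by (simp add: norm_vec_def L2_set_def sum_nonneg)

lemma quad_form_small_entries:
  fixes M :: "'n::finite \<Rightarrow> 'n \<Rightarrow> real"
  assumes "\<And>i j. \<bar>M i j\<bar> \<le> \<eta>"
  shows "quad_form M \<xi> \<le> \<eta> * CARD('n) * (norm \<xi>)\<^sup>2"
proof -
  have "0 \<le> \<eta>" using assms[of undefined undefined] by linarith
  have "M i j * \<xi> $ i * \<xi> $ j \<le> \<eta> / 2 * (\<xi> $ i)\<^sup>2 + \<eta> / 2 * (\<xi> $ j)\<^sup>2" for i j
  proof -
    have "M i j * \<xi> $ i * \<xi> $ j \<le> \<bar>M i j\<bar> * (\<bar>\<xi> $ i\<bar> * \<bar>\<xi> $ j\<bar>)"
      by (metis abs_ge_self abs_mult mult.assoc)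
    also have "\<dots> \<le> \<eta> * (\<bar>\<xi> $ i\<bar> * \<bar>\<xi> $ j\<bar>)"
      using assms by (intro mult_right_mono) auto
    also have "\<dots> \<le> \<eta> * (((\<xi> $ i)\<^sup>2 + (\<xi> $ j)\<^sup>2) / 2)"
      using sum_squares_bound[of "\<bar>\<xi> $ i\<bar>" "\<bar>\<xi> $ j\<bar>"] \<open>0 \<le> \<eta>\<close>
      by (intro mult_left_mono) auto
    finally show ?thesis by (simp add: field_simps)
  qed
  then have "quad_form M \<xi> \<le> (\<Sum>i\<in>UNIV. \<Sum>j\<in>UNIV. \<eta> / 2 * (\<xi> $ i)\<^sup>2 + \<eta> / 2 * (\<xi> $ j)\<^sup>2)"
    unfolding quad_form_def by (intro sum_mono)
  also have "\<dots> = \<eta> * CARD('n) * (norm \<xi>)\<^sup>2"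
    by (simp add: sum.distrib norm_power2_cart flip: sum_distrib_left sum_divide_distrib)
  finally show ?thesis .
qed

section \<open>Derivatives along lines\<close>

lemma partial_D_along_axis:
  assumes "C1_on \<Omega> u" "y + s *\<^sub>R axis i 1 \<in> \<Omega>"
  shows "((\<lambda>t. u (y + t *\<^sub>R axis i 1)) has_real_derivative partial_D i u (y + s *\<^sub>R axis i 1)) (at s)"
proof -
  let ?z = "y + s *\<^sub>R axis i 1"
  have "(\<lambda>t. u (?z + t *\<^sub>R axis i 1)) differentiable at 0"
    using assms by (auto simp: C1_on_def)
  then have "((\<lambda>t. u (?z + t *\<^sub>R axis i 1)) has_real_derivative partial_D i u ?z) (at 0)"
    unfolding partial_D_def by (simp add: DERIV_deriv_iff_real_differentiable)
  then have "((\<lambda>t. u (y + (s + t) *\<^sub>R axis i 1)) has_real_derivative partial_D i u ?z) (at 0)"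
    by (simp add: scaleR_add_left add.assoc)
  then show ?thesis
    using DERIV_at_within_shift[of "\<lambda>t. u (y + t *\<^sub>R axis i 1)" "partial_D i u ?z" s 0 UNIV]
    by simp
qed

text \<open>
  Continuous partial derivatives give total differentiability: the increment of \<open>u\<close> is built up one
  coordinate at a time, and the mean value inequality controls each step.
\<close>
lemma C1_on_has_derivative:
  fixes \<Omega> :: "(real ^ 'n::finite) set"
  assumes "open \<Omega>" and C1: "C1_on \<Omega> u" and "x \<in> \<Omega>"
  shows "(u has_derivative (\<lambda>h. \<Sum>i\<in>UNIV. partial_D i u x * h $ i)) (at x)"
  unfolding has_derivative_at_alt
proof (intro conjI allI impI)
  show "bounded_linear (\<lambda>h. \<Sum>i\<in>UNIV. partial_D i u x * h $ i)"
    by (intro bounded_linear_sum bounded_linear_mult_right[THEN bounded_linear_compose] bounded_linear_vec_nth)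
  fix e :: real assume "0 < e"
  define e' where "e' = e / CARD('n)"
  have "0 < e'" using \<open>0 < e\<close> by (simp add: e'_def)
  have "\<exists>d>0. \<forall>y. dist y x < d \<longrightarrow> \<bar>partial_D i u y - partial_D i u x\<bar> < e'" for i
  proof -
    have "isCont (partial_D i u) x"
      using C1 assms(1,3) by (auto simp: C1_on_def continuous_on_eq_continuous_at)
    then show ?thesis
      using \<open>0 < e'\<close> unfolding continuous_at_eps_delta by (auto simp: dist_real_def)
  qed
  then obtain d where d: "\<And>i. 0 < d i"
    "\<And>i y. dist y x < d i \<Longrightarrow> \<bar>partial_D i u y - partial_D i u x\<bar> < e'"
    by metis
  obtain d0 where d0: "0 < d0" "ball x d0 \<subseteq> \<Omega>"
    using assms(1,3) openE by blast
  define D where "D = min d0 (Min (range d))"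
  have "0 < D" using d(1) d0(1) by (simp add: D_def)
  have D: "y \<in> \<Omega>" "\<bar>partial_D i u y - partial_D i u x\<bar> < e'" if "dist y x < D" for y i
  proof -
    have "Min (range d) \<le> d i" by (intro Min_le) auto
    then show "\<bar>partial_D i u y - partial_D i u x\<bar> < e'" using d(2) that by (auto simp: D_def)
    show "y \<in> \<Omega>" using d0(2) that by (auto simp: D_def dist_commute)
  qed
  \<comment> \<open>Only the coordinates in \<open>S\<close> have been moved so far; the induction adds them one by one.\<close>
  have main: "\<bar>u (x + (\<Sum>i\<in>S. h $ i *\<^sub>R axis i 1)) - u x - (\<Sum>i\<in>S. partial_D i u x * h $ i)\<bar>
      \<le> (\<Sum>i\<in>S. e' * \<bar>h $ i\<bar>)" if h: "norm h < D" and "finite S" for S and h :: "real ^ 'n"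
    using \<open>finite S\<close>
  proof (induction S rule: finite_induct)
    case empty
    then show ?case by simp
  next
    case (insert k S)
    define z where "z = x + (\<Sum>i\<in>S. h $ i *\<^sub>R axis i 1)"
    \<comment> \<open>The segment of the next step stays close to \<open>x\<close>, because its points are dominated by \<open>h\<close> in every
      coordinate.\<close>
    have near: "dist (z + t *\<^sub>R axis k 1) x < D" if "\<bar>t\<bar> \<le> \<bar>h $ k\<bar>" for t
    proof -
      have "\<bar>((z - x) + t *\<^sub>R axis k 1) $ i\<bar> \<le> \<bar>h $ i\<bar>" for i
      proof -
        have "(h $ j *\<^sub>R axis j 1) $ i = (if j = i then h $ j else 0)" for j
          by (simp add: axis_def)
        then have "(z - x) $ i = (\<Sum>j\<in>S. if j = i then h $ j else 0)"
          by (simp add: z_def)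
        also have "\<dots> = (if i \<in> S then h $ i else 0)" using insert.hyps by simp
        finally have "(z - x) $ i = (if i \<in> S then h $ i else 0)" .
        then show ?thesis using that insert.hyps by (auto simp: axis_def)
      qed
      then have "norm ((z - x) + t *\<^sub>R axis k 1) \<le> norm h"
        by (intro norm_le_componentwise_cart) simp
      then show ?thesis using h by (simp add: dist_norm algebra_simps)
    qed
    have "\<bar>u (z + (h $ k) *\<^sub>R axis k 1) - u z - partial_D k u x * h $ k\<bar> \<le> e' * \<bar>h $ k\<bar>"
    proof -
      define f where "f t = u (z + t *\<^sub>R axis k 1) - t * partial_D k u x" for t
      have "norm (f (h $ k) - f 0) \<le> e' * norm (h $ k - 0)"
      proof (rule field_differentiable_bound[where S = "closed_segment 0 (h $ k)"])
        show "convex (closed_segment 0 (h $ k))" by simp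
        fix t assume t: "t \<in> closed_segment 0 (h $ k)"
        then have "\<bar>t\<bar> \<le> \<bar>h $ k\<bar>" by (auto simp: closed_segment_eq_real_ivl split: if_splits)
        note t' = near[OF this]
        have "(f has_real_derivative partial_D k u (z + t *\<^sub>R axis k 1) - partial_D k u x) (at t)"
          unfolding f_def
          by (auto intro!: derivative_eq_intros partial_D_along_axis[OF C1] D(1) t')
        then show "(f has_field_derivative partial_D k u (z + t *\<^sub>R axis k 1) - partial_D k u x) (at t within closed_segment 0 (h $ k))"
          by (rule has_field_derivative_at_within)
        show "norm (partial_D k u (z + t *\<^sub>R axis k 1) - partial_D k u x) \<le> e'"
          using D(2)[OF t', of k] by simp
      qed auto
      then show ?thesis by (simp add: f_def algebra_simps)
    qed
    moreover have "\<bar>u z - u x - (\<Sum>i\<in>S. partial_D i u x * h $ i)\<bar> \<le> (\<Sum>i\<in>S. e' * \<bar>h $ i\<bar>)"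
      using insert.IH by (simp add: z_def)
    moreover have eq: "x + (\<Sum>i\<in>insert k S. h $ i *\<^sub>R axis i 1) = z + (h $ k) *\<^sub>R axis k 1"
      using insert.hyps by (simp add: z_def algebra_simps)
    ultimately show ?case
      unfolding eq unfolding sum.insert[OF insert.hyps] by linarith
  qed
  show "\<exists>d>0. \<forall>y. norm (y - x) < d \<longrightarrow>
      norm (u y - u x - (\<Sum>i\<in>UNIV. partial_D i u x * (y - x) $ i)) \<le> e * norm (y - x)"
  proof (intro exI[of _ D] conjI allI impI \<open>0 < D\<close>)
    fix y assume y: "norm (y - x) < D"
    have "x + (\<Sum>i\<in>UNIV. (y - x) $ i *\<^sub>R axis i 1) = y"
      using basis_expansion[of "y - x"] by (simp add: scalar_mult_eq_scaleR)
    with main[OF y, of UNIV]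
    have "\<bar>u y - u x - (\<Sum>i\<in>UNIV. partial_D i u x * (y - x) $ i)\<bar> \<le> (\<Sum>i\<in>UNIV. e' * \<bar>(y - x) $ i\<bar>)"
      by simp
    also have "\<dots> \<le> (\<Sum>i\<in>(UNIV :: 'n set). e' * norm (y - x))"
      by (intro sum_mono mult_left_mono component_le_norm_cart) (use \<open>0 < e'\<close> in auto)
    also have "\<dots> = e * norm (y - x)" by (simp add: e'_def)
    finally show "norm (u y - u x - (\<Sum>i\<in>UNIV. partial_D i u x * (y - x) $ i)) \<le> e * norm (y - x)"
      by simp
  qed
qed

lemma C1_on_derivative_along_line:
  fixes \<Omega> :: "(real ^ 'n::finite) set"
  assumes "open \<Omega>" "C1_on \<Omega> u" "x + t *\<^sub>R \<xi> \<in> \<Omega>"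
  shows "((\<lambda>t. u (x + t *\<^sub>R \<xi>)) has_real_derivative (\<Sum>i\<in>UNIV. partial_D i u (x + t *\<^sub>R \<xi>) * \<xi> $ i)) (at t)"
proof -
  have "((\<lambda>t. x + t *\<^sub>R \<xi>) has_derivative (\<lambda>h. h *\<^sub>R \<xi>)) (at t)"
    by (auto intro!: derivative_eq_intros)
  note has_derivative_compose[OF this C1_on_has_derivative[OF assms]]
  moreover have "(\<lambda>h. \<Sum>i\<in>UNIV. partial_D i u (x + t *\<^sub>R \<xi>) * (h *\<^sub>R \<xi>) $ i)
      = (*) (\<Sum>i\<in>UNIV. partial_D i u (x + t *\<^sub>R \<xi>) * \<xi> $ i)"
    by (intro ext) (simp add: sum_distrib_left mult_ac)
  ultimately show ?thesis
    by (simp add: has_field_derivative_def)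
qed

definition hessian :: "(real ^ 'n \<Rightarrow> real) \<Rightarrow> real ^ 'n \<Rightarrow> 'n::finite \<Rightarrow> 'n \<Rightarrow> real"
  where "hessian u x i j = partial_D i (partial_D j u) x"

lemma eventually_line_in_open:
  fixes x \<xi> :: "'a::real_normed_vector"
  assumes "open U" "x \<in> U"
  shows "\<forall>\<^sub>F t in nhds 0. x + t *\<^sub>R \<xi> \<in> U"
proof -
  have "((\<lambda>t. x + t *\<^sub>R \<xi>) \<longlongrightarrow> x + 0 *\<^sub>R \<xi>) (nhds 0)"
    by (intro tendsto_intros filterlim_ident)
  from topological_tendstoD[OF this assms(1)] assms(2) show ?thesis by simp
qed

text \<open>
  The second derivative test. The linear coefficient \<open>b\<close> is arbitrary because the first order terms
  agree at a point of contact.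
\<close>
lemma quad_form_hessian_le_at_touching_parabola:
  fixes \<Omega> :: "(real ^ 'n::finite) set"
  assumes "open \<Omega>" and C2: "C2_on \<Omega> u" and x: "x \<in> \<Omega>"
    and max: "eventually (\<lambda>t. u (x + t *\<^sub>R \<xi>) \<le> u x + b * t + c * t\<^sup>2) (nhds 0)"
  shows "quad_form (hessian u x) \<xi> \<le> 2 * c"
proof (rule ccontr)
  assume less: "\<not> ?thesis"
  define f where "f t = u (x + t *\<^sub>R \<xi>) - b * t - c * t\<^sup>2" for t
  define f' where "f' t = (\<Sum>i\<in>UNIV. partial_D i u (x + t *\<^sub>R \<xi>) * \<xi> $ i) - b - 2 * c * t" for t
  have "eventually (\<lambda>t. x + t *\<^sub>R \<xi> \<in> \<Omega>) (nhds 0)"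
    using assms(1) x by (rule eventually_line_in_open)
  with max have "eventually (\<lambda>t. x + t *\<^sub>R \<xi> \<in> \<Omega> \<and> f t \<le> f 0) (nhds 0)"
    by eventually_elim (simp add: f_def)
  then obtain d where d: "0 < d" "\<And>t. \<bar>t\<bar> < d \<Longrightarrow> x + t *\<^sub>R \<xi> \<in> \<Omega>" "\<And>t. \<bar>t\<bar> < d \<Longrightarrow> f t \<le> f 0"
    unfolding eventually_nhds_metric by (auto simp: dist_real_def)
  have f': "(f has_real_derivative f' t) (at t)" if "\<bar>t\<bar> < d" for t
    unfolding f_def f'_def
    by (rule derivative_eq_intros C1_on_derivative_along_line[OF assms(1)] refl d(2) that
        | use C2 in \<open>simp add: C2_on_def\<close>)+
  have f'0: "f' 0 = 0"
    by (rule DERIV_local_max[OF f' d(1)]) (use d in auto)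
  have "((\<lambda>t. partial_D j u (x + t *\<^sub>R \<xi>)) has_real_derivative (\<Sum>i\<in>UNIV. hessian u x i j * \<xi> $ i)) (at 0)" for j
    using C1_on_derivative_along_line[OF assms(1), of "partial_D j u" x 0 \<xi>] C2 x
    by (simp add: C2_on_def hessian_def)
  note [derivative_intros] = this
  have "(f' has_real_derivative (\<Sum>j\<in>UNIV. (\<Sum>i\<in>UNIV. hessian u x i j * \<xi> $ i) * \<xi> $ j) - 2 * c) (at 0)"
    unfolding f'_def by (auto intro!: derivative_eq_intros)
  moreover have "(\<Sum>j\<in>UNIV. (\<Sum>i\<in>UNIV. hessian u x i j * \<xi> $ i) * \<xi> $ j) = quad_form (hessian u x) \<xi>"
    unfolding quad_form_def sum_distrib_right by (rule sum.swap)
  ultimately have "(f' has_real_derivative quad_form (hessian u x) \<xi> - 2 * c) (at 0)"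
    by simp
  then obtain e where e: "0 < e" "\<And>h. 0 < h \<Longrightarrow> h < e \<Longrightarrow> f' 0 < f' (0 + h)"
    using DERIV_pos_inc_right[of f' _ 0] less by force
  define t where "t = min d e / 2"
  have t: "0 < t" "t < d" "t < e" using d(1) e(1) by (auto simp: t_def)
  have "f 0 < f t"
  proof (rule DERIV_pos_imp_increasing_open[OF t(1)])
    fix s assume "0 < s" "s < t"
    then show "\<exists>y. DERIV f s :> y \<and> 0 < y"
      using f'[of s] e(2)[of s] f'0 t by (intro exI[of _ "f' s"]) auto
  next
    show "continuous_on {0..t} f"
    proof (rule DERIV_continuous_on)
      fix s assume "s \<in> {0..t}"
      then have "\<bar>s\<bar> < d" using t by auto
      from f'[OF this] show "(f has_real_derivative f' s) (at s within {0..t})"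
        by (rule has_field_derivative_at_within)
    qed
  qed
  with d(3)[of t] t show False by simp
qed

section \<open>Comparison with strict supersolutions\<close>

lemma AE_lebesgue_obtain_in_open:
  fixes U :: "'a::euclidean_space set"
  assumes "AE x in lebesgue. P x" "open U" "U \<noteq> {}"
  obtains x where "x \<in> U" "P x"
proof -
  have "\<not> (AE x in lebesgue. x \<notin> U)"
  proof
    assume "AE x in lebesgue. x \<notin> U"
    then have "negligible U"
      by (simp add: AE_iff_null_sets negligible_iff_null_sets assms(2))
    with assms(2,3) show False by (simp add: open_not_negligible)
  qed
  then show ?thesis using assms(1) that by (metis (mono_tags, lifting) eventually_mono)
qed

lemma elliptic_AE:
  assumes "uniformly_elliptic \<nu> a"
  shows "AE x in lebesgue. (\<forall>i j. a i j x = a j i x) \<and>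
    (\<forall>\<xi>. \<nu> * (norm \<xi>)\<^sup>2 \<le> quad_form (\<lambda>i j. a i j x) \<xi> \<and>
         quad_form (\<lambda>i j. a i j x) \<xi> \<le> inverse \<nu> * (norm \<xi>)\<^sup>2)"
proof -
  have "AE x in lebesgue. \<forall>i j. a i j x = a j i x"
    using assms by (simp add: uniformly_elliptic_def eventually_all_finite)
  moreover have "AE x in lebesgue. \<forall>\<xi>. \<nu> * (norm \<xi>)\<^sup>2 \<le> quad_form (\<lambda>i j. a i j x) \<xi> \<and>
         quad_form (\<lambda>i j. a i j x) \<xi> \<le> inverse \<nu> * (norm \<xi>)\<^sup>2"
    using assms by (simp add: uniformly_elliptic_def quad_form_def)
  ultimately show ?thesis by eventually_elim simp
qed

text \<open>
  The form on the right of the last hypothesis has the matrix \<open>c (I - 2n/\<nu>\<^sup>2 e\<^sub>k e\<^sub>k\<^sup>T)\<close>. Pairing it with an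
  admissible coefficient matrix gives at most \<open>c (n/\<nu> - 2n/\<nu>\<^sup>2 \<sqdot> \<nu>) = - c n/\<nu>\<close>, since the trace is at
  most \<open>n/\<nu>\<close> and the diagonal entry at least \<open>\<nu>\<close>. Half of this negative amount pays for moving from
  \<open>x\<close> to a nearby point at which the coefficients are admissible and \<open>Lu \<ge> 0\<close>;
  such points are dense because these properties hold almost everywhere.
\<close>
lemma subsolution_hessian_not_below:
  fixes \<Omega> :: "(real ^ 'n::finite) set"
  assumes "open \<Omega>" and ell: "uniformly_elliptic \<nu> a" and C2: "C2_on \<Omega> u"
    and Lu: "AE x in lebesgue. x \<in> \<Omega> \<longrightarrow> 0 \<le> L_op a u x"
    and x: "x \<in> \<Omega>" and "0 < c"
    and below: "\<And>\<xi>. quad_form (hessian u x) \<xi> \<le> c * ((norm \<xi>)\<^sup>2 - 2 * real CARD('n) / \<nu>\<^sup>2 * (\<xi> $ k)\<^sup>2)"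
  shows False
proof -
  define n where "n = real CARD('n)"
  have n: "0 < n" by (simp add: n_def)
  have \<nu>: "0 < \<nu>" using ell by (simp add: uniformly_elliptic_def)
  \<comment> \<open>Entries smaller than \<open>\<eta>\<close> perturb the quadratic form by at most \<open>c/2 |\<xi>|\<^sup>2\<close>.\<close>
  define \<eta> where "\<eta> = c / (2 * n)"
  have \<eta>: "0 < \<eta>" using \<open>0 < c\<close> n by (simp add: \<eta>_def)
  have "\<forall>\<^sub>F z in nhds x. \<bar>hessian u z i j - hessian u x i j\<bar> < \<eta>" for i j
  proof -
    have "isCont (\<lambda>z. hessian u z i j) x"
      using C2 assms(1) x
      by (auto simp: C2_on_def C1_on_def hessian_def continuous_on_eq_continuous_at)
    then have "((\<lambda>z. hessian u z i j) \<longlongrightarrow> hessian u x i j) (nhds x)"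
      using tendsto_at_iff_tendsto_nhds isCont_def by metis
    from tendstoD[OF this \<eta>] show ?thesis by (simp add: dist_real_def)
  qed
  then have "\<forall>\<^sub>F z in nhds x. z \<in> \<Omega> \<and> (\<forall>i j. \<bar>hessian u z i j - hessian u x i j\<bar> < \<eta>)"
    by (intro eventually_conj eventually_all_finite eventually_nhds_in_open assms(1) x)
  then obtain U where U: "open U" "x \<in> U"
    "\<And>z. z \<in> U \<Longrightarrow> z \<in> \<Omega> \<and> (\<forall>i j. \<bar>hessian u z i j - hessian u x i j\<bar> < \<eta>)"
    unfolding eventually_nhds by auto
  obtain z where z: "z \<in> U" and good: "(z \<in> \<Omega> \<longrightarrow> 0 \<le> L_op a u z) \<and> (\<forall>i j. a i j z = a j i z) \<and>
      (\<forall>\<xi>. \<nu> * (norm \<xi>)\<^sup>2 \<le> quad_form (\<lambda>i j. a i j z) \<xi> \<and>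
           quad_form (\<lambda>i j. a i j z) \<xi> \<le> inverse \<nu> * (norm \<xi>)\<^sup>2)"
    by (rule AE_lebesgue_obtain_in_open[OF AE_conjI[OF Lu elliptic_AE[OF ell]] U(1)]) (use U(2) in auto)
  note Lz = good[THEN conjunct1] and sym = good[THEN conjunct2, THEN conjunct1, rule_format]
    and lower = good[THEN conjunct2, THEN conjunct2, rule_format, THEN conjunct1]
    and upper = good[THEN conjunct2, THEN conjunct2, rule_format, THEN conjunct2]
  \<comment> \<open>The upper bound for the Hessian at \<open>z\<close> is diagonal, with entries \<open>d\<close>: the given bound at \<open>x\<close> plus
    the perturbation \<open>c/2\<close>.\<close>
  define d where "d i = 3 * c / 2 - (if i = k then c * (2 * n / \<nu>\<^sup>2) else 0)" for i
  define M where "M i j = (if i = j then d i else 0) - hessian u z i j" for i j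
  have "0 \<le> quad_form M \<xi>" for \<xi>
  proof -
    have "quad_form (hessian u z) \<xi> - quad_form (hessian u x) \<xi> \<le> \<eta> * CARD('n) * (norm \<xi>)\<^sup>2"
      unfolding quad_form_diff[symmetric] using U(3)[OF z]
      by (intro quad_form_small_entries) (simp add: less_imp_le)
    also have "\<dots> = c / 2 * (norm \<xi>)\<^sup>2" using n by (simp add: \<eta>_def n_def[symmetric])
    finally have "quad_form (hessian u z) \<xi> \<le> c * ((norm \<xi>)\<^sup>2 - 2 * n / \<nu>\<^sup>2 * (\<xi> $ k)\<^sup>2) + c / 2 * (norm \<xi>)\<^sup>2"
      using below[of \<xi>] by (simp add: n_def)
    also have "\<dots> = 3 * c / 2 * (norm \<xi>)\<^sup>2 - c * (2 * n / \<nu>\<^sup>2) * (\<xi> $ k)\<^sup>2"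
      by (simp add: algebra_simps)
    also have "\<dots> = (\<Sum>i\<in>UNIV. 3 * c / 2 * (\<xi> $ i)\<^sup>2 - (if i = k then c * (2 * n / \<nu>\<^sup>2) * (\<xi> $ i)\<^sup>2 else 0))"
      by (simp add: sum_subtractf norm_power2_cart sum_distrib_left)
    also have "\<dots> = (\<Sum>i\<in>UNIV. d i * (\<xi> $ i)\<^sup>2)"
      by (intro sum.cong) (auto simp: d_def algebra_simps)
    finally show ?thesis
      unfolding M_def quad_form_diff quad_form_diagonal by simp
  qed
  moreover have "0 \<le> quad_form (\<lambda>i j. a i j z) \<xi>" for \<xi>
    using lower[of \<xi>] \<nu> by (meson order_trans mult_nonneg_nonneg less_imp_le zero_le_power2)
  ultimately have "0 \<le> (\<Sum>i\<in>UNIV. \<Sum>j\<in>UNIV. a i j z * M i j)"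
    using psd_pairing_nonneg[of "\<lambda>i j. a i j z" M] sym by blast
  also have "\<dots> = (\<Sum>i\<in>UNIV. \<Sum>j\<in>UNIV. (if j = i then a i i z * d i else 0) - a i j z * hessian u z i j)"
    by (intro sum.cong) (auto simp: M_def algebra_simps)
  also have "\<dots> = (\<Sum>i\<in>UNIV. a i i z * d i) - L_op a u z"
    by (simp add: sum_subtractf L_op_def hessian_def)
  also have "(\<Sum>i\<in>UNIV. a i i z * d i) = (\<Sum>i\<in>UNIV. 3 * c / 2 * a i i z - (if i = k then c * (2 * n / \<nu>\<^sup>2) * a i i z else 0))"
    by (intro sum.cong) (auto simp: d_def algebra_simps)
  also have "\<dots> = 3 * c / 2 * (\<Sum>i\<in>UNIV. a i i z) - c * (2 * n / \<nu>\<^sup>2) * a k k z"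
    by (simp add: sum_subtractf sum_distrib_left)
  also have "\<dots> \<le> 3 * c / 2 * (n / \<nu>) - c * (2 * n / \<nu>\<^sup>2) * \<nu>"
  proof (intro diff_mono mult_left_mono)
    have "a i i z \<le> 1 / \<nu>" for i
      using upper[of "axis i 1"] by (simp add: quad_form_axis inverse_eq_divide)
    then have "(\<Sum>i\<in>UNIV. a i i z) \<le> (\<Sum>i\<in>(UNIV :: 'n set). 1 / \<nu>)"
      by (intro sum_mono)
    then show "(\<Sum>i\<in>UNIV. a i i z) \<le> n / \<nu>" by (simp add: n_def)
    show "\<nu> \<le> a k k z" using lower[of "axis k 1"] by (simp add: quad_form_axis)
  qed (use \<open>0 < c\<close> n \<nu> in auto)
  also have "\<dots> = - (c * n / (2 * \<nu>))"
    using \<nu> by (simp add: field_simps power2_eq_square)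
  also have "\<dots> < 0" using \<open>0 < c\<close> n \<nu> by simp
  finally show False using Lz U(3)[OF z] by simp
qed

section \<open>Passing from one scale to the next\<close>

text \<open>
  An additive error \<open>K\<close> on a ball turns into an error in the slope on half the ball, while the slope
  \<open>m\<close> itself is not multiplied by any constant. Around a point \<open>x0\<close> of height at most \<open>\<rho> = R/2\<close> the
  comparison function is \<open>m y + K \<phi>\<close>, where \<open>y\<close> is the height and
  \<open>\<phi> = |x - x0|\<^sup>2/\<rho>\<^sup>2 + B (y/\<rho>) (2 - y/\<rho>)\<close>. In the ball of radius \<open>\<rho>\<close> about \<open>x0\<close> the height is at
  most \<open>2\<rho>\<close>, so the second summand is non-negative there, and \<open>\<phi> \<ge> 1\<close> on the sphere. The concave
  term in \<open>y\<close> outweighs the convex first summand for every admissible operator, and at \<open>x0\<close> the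
  function \<open>\<phi>\<close> is bounded by the linear term \<open>2 B y/\<rho>\<close>. At points higher than \<open>\<rho>\<close> the claim is
  weaker than the hypothesis.
\<close>
lemma linear_bound_improves_on_half_ball:
  fixes \<Omega> :: "(real ^ 'n::finite) set"
  assumes "open \<Omega>" and ell: "uniformly_elliptic \<nu> a" and C2: "C2_on \<Omega> u"
    and cont: "continuous_on (closure \<Omega>) u"
    and Lu: "AE x in lebesgue. x \<in> \<Omega> \<longrightarrow> 0 \<le> L_op a u x"
    and "0 < R" "0 \<le> m" "0 \<le> K"
    and zero: "\<And>x. x \<in> frontier \<Omega> \<inter> ball 0 R \<Longrightarrow> u x = 0"
    and half: "\<And>x. x \<in> \<Omega> \<inter> ball 0 R \<Longrightarrow> 0 \<le> x $ k + s"
    and bound: "\<And>x. x \<in> \<Omega> \<inter> ball 0 R \<Longrightarrow> u x \<le> m * (x $ k + s) + K"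
    and x0: "x0 \<in> \<Omega> \<inter> ball 0 (R / 2)"
  shows "u x0 \<le> (m + 4 * (2 * real CARD('n) / \<nu>\<^sup>2) * K / R) * (x0 $ k + s)"
proof -
  define B where "B = 2 * real CARD('n) / \<nu>\<^sup>2"
  have \<nu>: "0 < \<nu>" "\<nu> \<le> 1" using ell by (auto simp: uniformly_elliptic_def)
  have "1 \<le> B"
  proof -
    have "\<nu>\<^sup>2 \<le> 1" using \<nu> by (simp add: power_le_one)
    also have "1 \<le> real CARD('n)" by (simp add: Suc_le_eq)
    finally have "\<nu>\<^sup>2 \<le> 2 * real CARD('n)" by simp
    then show ?thesis using \<nu> by (simp add: B_def)
  qed
  define \<rho> where "\<rho> = R / 2"
  have \<rho>: "0 < \<rho>" using \<open>0 < R\<close> by (simp add: \<rho>_def)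
  define y where "y x = x $ k + s" for x :: "real ^ 'n"
  have R_half: "x0 \<in> \<Omega>" "x0 \<in> ball 0 R" "norm x0 < \<rho>"
    using x0 \<open>0 < R\<close> by (auto simp: \<rho>_def)
  have y0: "0 \<le> y x0" "u x0 \<le> m * y x0 + K"
    using half[of x0] bound[of x0] R_half by (auto simp: y_def)
  have "u x0 \<le> m * y x0 + 2 * B * K / \<rho> * y x0"
  proof (cases "K = 0 \<or> \<rho> < y x0")
    case True
    have "K \<le> 2 * B * K / \<rho> * y x0"
    proof (cases "K = 0")
      case False
      with True have "\<rho> \<le> 2 * B * y x0" using \<open>1 \<le> B\<close> \<rho>
        by (smt (verit) mult_le_cancel_right1)
      then have "K * \<rho> \<le> K * (2 * B * y x0)" using \<open>0 \<le> K\<close> by (rule mult_left_mono)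
      then show ?thesis using \<rho> by (simp add: field_simps)
    qed simp
    then show ?thesis using y0 by simp
  next
    case False
    then have "0 < K" "y x0 \<le> \<rho>" using \<open>0 \<le> K\<close> by auto
    define \<phi> where "\<phi> x = (norm (x - x0))\<^sup>2 / \<rho>\<^sup>2 + 2 * B * y x / \<rho> - B * (y x)\<^sup>2 / \<rho>\<^sup>2" for x
    define F where "F x = u x - m * y x - K * \<phi> x" for x
    \<comment> \<open>The comparison takes place on the closure of \<open>\<Omega>\<close>, and its boundary points must not lie below the
      hyperplane either.\<close>
    have closure_above: "0 \<le> y z" if "z \<in> closure \<Omega>" "norm z < R" for z
    proof -
      have z: "z \<in> closure (\<Omega> \<inter> ball 0 R)"
        using open_Int_closure_subset[of "ball 0 R" \<Omega>] that by (auto simp: Int_commute)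
      show ?thesis
        by (rule continuous_ge_on_closure[OF _ z])
          (use half in \<open>auto simp: y_def intro!: continuous_intros\<close>)
    qed
    have \<phi>_ge: "(norm (x - x0))\<^sup>2 / \<rho>\<^sup>2 \<le> \<phi> x" if "0 \<le> y x" "norm (x - x0) \<le> \<rho>" for x
    proof -
      have "y x - y x0 = (x - x0) $ k" by (simp add: y_def)
      also have "\<dots> \<le> \<rho>" using component_le_norm_cart[of "x - x0" k] that by linarith
      finally have "y x \<le> 2 * \<rho>" using \<open>y x0 \<le> \<rho>\<close> by simp
      then have "0 \<le> B * (y x * (2 * \<rho> - y x)) / \<rho>\<^sup>2"
        using that \<open>1 \<le> B\<close> by simp
      also have "\<dots> = 2 * B * y x / \<rho> - B * (y x)\<^sup>2 / \<rho>\<^sup>2"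
        using \<rho> by (simp add: field_simps power2_eq_square)
      finally show ?thesis by (simp add: \<phi>_def)
    qed
    define D where "D = closure \<Omega> \<inter> cball x0 \<rho>"
    have D: "z \<in> closure \<Omega>" "norm (z - x0) \<le> \<rho>" "norm z < R" if "z \<in> D" for z
    proof -
      show 1: "z \<in> closure \<Omega>" "norm (z - x0) \<le> \<rho>"
        using that by (auto simp: D_def dist_norm norm_minus_commute)
      show "norm z < R"
        using 1(2) R_half(3) norm_triangle_ineq[of "z - x0" x0] by (simp add: \<rho>_def)
    qed
    have "x0 \<in> D" using R_half(1) \<rho> closure_subset[of \<Omega>] by (auto simp: D_def)
    have "compact D" unfolding D_def by (intro closed_Int_compact) auto
    moreover have "D \<noteq> {}" using \<open>x0 \<in> D\<close> by blast
    moreover have "continuous_on D F"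
      unfolding F_def \<phi>_def y_def
      by (intro continuous_intros continuous_on_subset[OF cont]) (use \<rho> in \<open>auto simp: D_def\<close>)
    ultimately obtain z where z: "z \<in> D" and z_max: "\<And>x. x \<in> D \<Longrightarrow> F x \<le> F z"
      using continuous_attains_sup by metis
    note zD = D[OF z]
    have yz: "0 \<le> y z" using closure_above zD by auto
    have "F z \<le> 0"
    proof (cases "z \<in> \<Omega>")
      case False
      then have "z \<in> frontier \<Omega>" using zD(1) assms(1) by (simp add: frontier_def interior_open)
      then have "u z = 0" using zero zD(3) by simp
      moreover have "0 \<le> \<phi> z" using \<phi>_ge[OF yz zD(2)] by (meson order_trans zero_le_divide_iff zero_le_power2)
      moreover have "0 \<le> m * y z" using \<open>0 \<le> m\<close> yz by simp
      moreover have "0 \<le> K * \<phi> z" using \<open>0 \<le> K\<close> calculation by simp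
      ultimately show ?thesis by (simp add: F_def)
    next
      case True
      show ?thesis
      proof (cases "norm (z - x0) = \<rho>")
        case on_sphere: True
        then have "(norm (z - x0))\<^sup>2 / \<rho>\<^sup>2 = 1" using \<rho> by simp
        then have "1 \<le> \<phi> z" using \<phi>_ge[OF yz zD(2)] by linarith
        then have "K \<le> K * \<phi> z" using \<open>0 < K\<close> by simp
        moreover have "u z \<le> m * y z + K" using bound[of z] True zD(3) by (simp add: y_def)
        ultimately show ?thesis by (simp add: F_def)
      next
        case False
        then have inside: "z \<in> \<Omega> \<inter> ball x0 \<rho>" using True zD by (auto simp: dist_norm norm_minus_commute)
        have "quad_form (hessian u z) \<xi> \<le> 2 * K / \<rho>\<^sup>2 * ((norm \<xi>)\<^sup>2 - 2 * real CARD('n) / \<nu>\<^sup>2 * (\<xi> $ k)\<^sup>2)" for \<xi>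
        proof -
          \<comment> \<open>Along a line the comparison function is a parabola; \<open>b\<close> and \<open>c\<close> are its coefficients.\<close>
          define b where "b = m * \<xi> $ k + K * (2 * (inner (z - x0) \<xi>) / \<rho>\<^sup>2 + 2 * B * \<xi> $ k / \<rho> - 2 * B * y z * \<xi> $ k / \<rho>\<^sup>2)"
          define c where "c = K / \<rho>\<^sup>2 * ((norm \<xi>)\<^sup>2 - B * (\<xi> $ k)\<^sup>2)"
          have line: "m * y (z + t *\<^sub>R \<xi>) + K * \<phi> (z + t *\<^sub>R \<xi>) = m * y z + K * \<phi> z + b * t + c * t\<^sup>2" for t
          proof -
            have N: "(norm (z + t *\<^sub>R \<xi> - x0))\<^sup>2 = (norm (z - x0))\<^sup>2 + 2 * t * inner (z - x0) \<xi> + t\<^sup>2 * (norm \<xi>)\<^sup>2"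
              unfolding power2_norm_eq_inner
              by (simp add: algebra_simps inner_commute power2_eq_square)
            have Y: "y (z + t *\<^sub>R \<xi>) = y z + t * \<xi> $ k" by (simp add: y_def)
            show ?thesis
              unfolding \<phi>_def b_def c_def N Y
              by (simp add: algebra_simps add_divide_distrib diff_divide_distrib power2_eq_square)
          qed
          have "\<forall>\<^sub>F t in nhds 0. z + t *\<^sub>R \<xi> \<in> \<Omega> \<inter> ball x0 \<rho>"
            using open_Int[OF assms(1) open_ball] inside by (rule eventually_line_in_open)
          then have "\<forall>\<^sub>F t in nhds 0. u (z + t *\<^sub>R \<xi>) \<le> u z + b * t + c * t\<^sup>2"
          proof eventually_elim
            case (elim t)
            then have "z + t *\<^sub>R \<xi> \<in> D" using closure_subset[of \<Omega>] by (auto simp: D_def)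
            from z_max[OF this] show ?case using line[of t] by (simp add: F_def)
          qed
          from quad_form_hessian_le_at_touching_parabola[OF assms(1) C2 True this]
          have "quad_form (hessian u z) \<xi> \<le> 2 * c" .
          also have "\<dots> = 2 * K / \<rho>\<^sup>2 * ((norm \<xi>)\<^sup>2 - B * (\<xi> $ k)\<^sup>2)" by (simp add: c_def)
          finally show ?thesis by (simp only: B_def)
        qed
        moreover have "0 < 2 * K / \<rho>\<^sup>2" using \<open>0 < K\<close> \<rho> by simp
        ultimately have False
          by (intro subsolution_hessian_not_below[OF assms(1) ell C2 Lu True])
        then show ?thesis ..
      qed
    qed
    moreover have "F x0 \<le> F z" by (rule z_max[OF \<open>x0 \<in> D\<close>])
    ultimately have "u x0 \<le> m * y x0 + K * \<phi> x0" by (simp add: F_def)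
    also have "K * \<phi> x0 \<le> K * (2 * B * y x0 / \<rho>)"
      using \<open>0 \<le> K\<close> \<open>1 \<le> B\<close> by (intro mult_left_mono) (auto simp: \<phi>_def)
    finally show ?thesis by (simp add: mult_ac)
  qed
  then show ?thesis by (simp add: y_def B_def \<rho>_def algebra_simps)
qed

section \<open>Dini condition and exterior condition\<close>

text \<open>
  On the interval from \<open>R\<^sub>j\<^sub>+\<^sub>1\<close> to \<open>R\<^sub>j\<close> the integrand \<open>\<psi>(r)/r\<^sup>2\<close> is at least \<open>\<psi>(R\<^sub>j\<^sub>+\<^sub>1)/R\<^sub>j\<^sup>2\<close>, and the interval
  has length \<open>R\<^sub>j/2\<close>, so it contributes at least a quarter of \<open>\<psi>(R\<^sub>j\<^sub>+\<^sub>1)/R\<^sub>j\<^sub>+\<^sub>1\<close>. The sum over all scales is thus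
  dominated by the integral of a step function below the integrand.
\<close>
lemma dyadic_sum_bounded_of_dini:
  assumes "0 < r0" and nonneg: "\<And>r. r \<in> {0..r0} \<Longrightarrow> 0 \<le> \<psi> r" and mono: "mono_on {0..r0} \<psi>"
    and fin: "dini_integral r0 \<psi> < \<infinity>"
  obtains S where "\<And>N. (\<Sum>j<N. \<psi> (r0 / 2 ^ j) / (r0 / 2 ^ j)) \<le> S"
proof -
  define R where "R j = r0 / 2 ^ j" for j :: nat
  have R: "0 < R j" "R j \<le> r0" "R (Suc j) = R j / 2" for j
    using \<open>0 < r0\<close> by (auto simp: R_def field_simps)
  have R_anti: "R j \<le> R i" if "i \<le> j" for i j
    using that \<open>0 < r0\<close> by (auto simp: R_def intro!: divide_left_mono power_increasing)
  define I where "I j = {R (Suc j)<..R j}" for j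
  define c where "c j = \<psi> (R (Suc j)) / (R j)\<^sup>2" for j
  have c: "0 \<le> c j" for j using nonneg[of "R (Suc j)"] R[of "Suc j"] by (simp add: c_def)
  have step: "(\<Sum>j<N. ennreal (c j) * indicator (I j) r) \<le> ennreal (\<psi> r / r\<^sup>2) * indicator {0<..r0} r" for N r
  proof (cases "\<exists>i<N. r \<in> I i")
    case False
    then have "(\<Sum>j<N. ennreal (c j) * indicator (I j) r) = 0" by (intro sum.neutral) auto
    then show ?thesis by simp
  next
    case True
    then obtain i where i: "i < N" "r \<in> I i" by blast
    have other: "r \<notin> I j" if "j \<noteq> i" for j
      using i(2) R_anti[of "Suc i" j] R_anti[of "Suc j" i] that by (cases "j < i") (auto simp: I_def)
    have "(\<Sum>j<N. ennreal (c j) * indicator (I j) r) = (\<Sum>j<N. if j = i then ennreal (c i) else 0)"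
      using i(2) other by (intro sum.cong) (auto split: split_indicator)
    also have "\<dots> = ennreal (c i)" using i(1) by simp
    also have "\<dots> \<le> ennreal (\<psi> r / r\<^sup>2)"
    proof (rule ennreal_leI)
      have r: "0 < r" "r \<le> R i" "R (Suc i) \<le> r" using i(2) R(1)[of "Suc i"] by (auto simp: I_def)
      then have "\<psi> (R (Suc i)) \<le> \<psi> r"
        using R(1)[of "Suc i"] R(2)[of i] by (intro mono_onD[OF mono]) auto
      moreover have "0 \<le> \<psi> r" using r R(2)[of i] by (intro nonneg) auto
      ultimately show "c i \<le> \<psi> r / r\<^sup>2"
        unfolding c_def using r by (intro frac_le power_mono) auto
    qed
    also have "\<dots> = ennreal (\<psi> r / r\<^sup>2) * indicator {0<..r0} r"
      using i(2) R(1)[of "Suc i"] R(2)[of i] by (auto simp: I_def)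
    finally show ?thesis .
  qed
  obtain T where T: "0 \<le> T" "dini_integral r0 \<psi> = ennreal T"
    using fin by (cases "dini_integral r0 \<psi>") auto
  have tail: "(\<Sum>j<N. c j * (R j / 2)) \<le> T" for N
  proof -
    have "ennreal (\<Sum>j<N. c j * (R j / 2)) = (\<Sum>j<N. ennreal (c j) * emeasure lborel (I j))"
    proof -
      have "emeasure lborel (I j) = ennreal (R j / 2)" for j
        using R(1)[of j] by (simp add: I_def R(3))
      then show ?thesis using c R(1)
        by (subst sum_ennreal[symmetric]) (simp_all add: ennreal_mult less_imp_le flip: times_divide_eq_right)
    qed
    also have "\<dots> = (\<integral>\<^sup>+ r. (\<Sum>j<N. ennreal (c j) * indicator (I j) r) \<partial>lborel)"
      by (subst nn_integral_sum) (auto simp: I_def nn_integral_cmult_indicator)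
    also have "\<dots> \<le> ennreal T"
      unfolding T(2)[symmetric] dini_integral_def by (intro nn_integral_mono step)
    finally show ?thesis using T(1) by simp
  qed
  have "(\<Sum>j<N. \<psi> (R j) / R j) \<le> \<psi> r0 / r0 + 4 * T" for N
  proof -
    have nn: "0 \<le> \<psi> (R j) / R j" for j using nonneg[of "R j"] R(1,2)[of j] by simp
    have "(\<Sum>j<N. \<psi> (R j) / R j) \<le> (\<Sum>j<Suc N. \<psi> (R j) / R j)" using nn[of N] by simp
    also have "\<dots> = \<psi> r0 / r0 + (\<Sum>j<N. \<psi> (R (Suc j)) / R (Suc j))"
      by (subst sum.lessThan_Suc_shift) (simp add: R_def)
    also have "(\<Sum>j<N. \<psi> (R (Suc j)) / R (Suc j)) = 4 * (\<Sum>j<N. c j * (R j / 2))"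
      unfolding sum_distrib_left using R(1)
      by (intro sum.cong) (auto simp: c_def R(3) field_simps power2_eq_square)
    also have "\<psi> r0 / r0 + \<dots> \<le> \<psi> r0 / r0 + 4 * T" using tail[of N] by simp
    finally show ?thesis .
  qed
  then show ?thesis using that unfolding R_def by blast
qed

text \<open>
  A point of the ball below the hyperplane lies in the reflected region: monotonicity bounds \<open>\<psi>\<close>
  at its distance from the axis by \<open>\<psi> R\<close>, and the height restriction of the region holds
  because the point is in the ball of radius \<open>r0\<close> and \<open>\<psi>\<close> is non-negative.
\<close>
lemma exterior_Q_imp_above_half_space:
  assumes ext: "exterior_Q_condition k r0 \<psi> \<Omega>"
    and nonneg: "\<And>r. r \<in> {0..r0} \<Longrightarrow> 0 \<le> \<psi> r" and mono: "mono_on {0..r0} \<psi>"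
    and "R \<le> r0" and x: "x \<in> \<Omega> \<inter> ball 0 R"
  shows "0 \<le> x $ k + \<psi> R"
proof (rule ccontr)
  assume below: "\<not> ?thesis"
  have "norm_prime k x \<le> norm x"
    unfolding norm_prime_def norm_vec_def L2_set_def
    by (simp add: sum_mono2)
  then have le: "norm_prime k x < R" using x by simp
  have ge: "0 \<le> norm_prime k x" by (simp add: norm_prime_def)
  have \<psi>: "\<psi> (norm_prime k x) \<le> \<psi> R" "0 \<le> \<psi> (norm_prime k x)"
    using mono_onD[OF mono, of "norm_prime k x" R] nonneg[of "norm_prime k x"] le ge \<open>R \<le> r0\<close> by auto
  have "norm_prime k (- x) = norm_prime k x" by (simp add: norm_prime_def L2_set_def)
  moreover have "- (x $ k) < r0"
    using component_le_norm_cart[of x k] x \<open>R \<le> r0\<close> by auto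
  ultimately have "- x \<in> Q_region k r0 \<psi>"
    using below \<psi> le \<open>R \<le> r0\<close> by (auto simp: Q_region_def)
  with ext x show False by (auto simp: exterior_Q_condition_def)
qed

section \<open>Linear growth at the boundary point\<close>

theorem theorem1p9:
  fixes \<Omega> :: "(real ^ 'n::finite) set"
    and k :: 'n
    and r0 \<nu> :: real
    and \<psi> :: "real \<Rightarrow> real"
    and a :: "'n \<Rightarrow> 'n \<Rightarrow> real ^ 'n \<Rightarrow> real"
    and u :: "real ^ 'n \<Rightarrow> real"
  assumes "open \<Omega>" and "bounded \<Omega>" and "0 \<in> frontier \<Omega>"
    and "0 < r0"
    and "\<And>r. r \<in> {0..r0} \<Longrightarrow> 0 \<le> \<psi> r"
    and "mono_on {0..r0} \<psi>"
    and "\<psi> r0 < r0"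
    and "dini_integral r0 \<psi> < \<infinity>"
    and "exterior_Q_condition k r0 \<psi> \<Omega>"
    and "uniformly_elliptic \<nu> a"
    and "C2_on \<Omega> u" and "continuous_on (closure \<Omega>) u"
    and "\<And>x. x \<in> \<Omega> \<Longrightarrow> 0 < u x"
    and "AE x in lebesgue. x \<in> \<Omega> \<longrightarrow> 0 \<le> L_op a u x"
    and "\<And>x. x \<in> frontier \<Omega> \<inter> ball 0 r0 \<Longrightarrow> u x = 0"
  shows "(SUP x \<in> \<Omega> \<inter> ball 0 r0. ereal (u x / norm x)) < \<infinity>"
proof -
  define B where "B = 2 * real CARD('n) / \<nu>\<^sup>2"
  have "0 \<le> B" by (simp add: B_def)
  define R where "R j = r0 / 2 ^ j" for j :: nat
  have R: "0 < R j" "R j \<le> r0" "R (Suc j) = R j / 2" for j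
    using \<open>0 < r0\<close> by (auto simp: R_def field_simps)
  define \<delta> where "\<delta> j = \<psi> (R j) / R j" for j
  have \<delta>: "0 \<le> \<delta> j" "\<psi> (R j) = \<delta> j * R j" for j
    using assms(5)[of "R j"] R(1,2)[of j] by (auto simp: \<delta>_def)
  obtain S where S: "(\<Sum>j<N. \<delta> j) \<le> S" for N
    using dyadic_sum_bounded_of_dini[OF assms(4,5,6,8)] unfolding \<delta>_def R_def by blast
  have \<delta>_le: "\<delta> j \<le> S" for j
    using S[of "Suc j"] sum_nonneg[of "{..<j}" \<delta>] \<delta>(1) by simp
  have "0 \<le> S" using S[of 0] by simp
  have "bounded (u ` closure \<Omega>)"
    using assms(2,12) by (intro compact_imp_bounded compact_continuous_image) (auto simp: compact_closure)
  then obtain K where K: "0 < K" "\<And>x. x \<in> closure \<Omega> \<Longrightarrow> \<bar>u x\<bar> \<le> K"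
    unfolding bounded_pos by auto
  then have uK: "u x \<le> K" if "x \<in> \<Omega>" for x
    using closure_subset that by (metis abs_le_D1 subsetD)
  note improve = linear_bound_improves_on_half_ball[OF assms(1,10,11,12,14), where k = k, folded B_def]
  \<comment> \<open>The first slope comes from the bound \<open>u \<le> K\<close>. The factor 8 is the factor 4 of the comparison lemma,
    doubled because the error \<open>\<psi> (R j)\<close> is measured against the radius \<open>R (Suc j) = R j / 2\<close>.\<close>
  define m where "m j = 4 * B * K / r0 * (\<Prod>i<j. 1 + 8 * B * \<delta> i)" for j
  have m_nonneg: "0 \<le> m j" for j
    unfolding m_def using \<open>0 \<le> B\<close> \<open>0 < K\<close> \<open>0 < r0\<close> \<delta>(1)
    by (intro mult_nonneg_nonneg prod_nonneg divide_nonneg_nonneg) auto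
  define M where "M = 4 * B * K / r0 * exp (8 * B * S)"
  have m_le: "m j \<le> M" for j
  proof -
    have "(\<Prod>i<j. 1 + 8 * B * \<delta> i) \<le> (\<Prod>i<j. exp (8 * B * \<delta> i))"
      using \<delta>(1) \<open>0 \<le> B\<close> by (intro prod_mono) (auto simp: exp_ge_add_one_self)
    also have "\<dots> = exp (8 * B * (\<Sum>i<j. \<delta> i))" by (simp add: exp_sum sum_distrib_left)
    also have "\<dots> \<le> exp (8 * B * S)" using S[of j] \<open>0 \<le> B\<close> by (simp add: mult_left_mono)
    finally show ?thesis
      unfolding m_def M_def using \<open>0 \<le> B\<close> \<open>0 < K\<close> \<open>0 < r0\<close> by (intro mult_left_mono) auto
  qed
  have scale: "u x \<le> m j * (x $ k + \<psi> (R j))" if "x \<in> \<Omega> \<inter> ball 0 (R (Suc j))" for j x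
    using that
  proof (induction j arbitrary: x)
    case 0
    have "u x \<le> (0 + 4 * B * K / r0) * (x $ k + \<psi> r0)"
    proof (rule improve)
      show "0 \<le> z $ k + \<psi> r0" if "z \<in> \<Omega> \<inter> ball 0 r0" for z
        by (rule exterior_Q_imp_above_half_space[OF assms(9,5,6) _ that]) auto
    qed (use 0 assms(4,15) K(1) uK in \<open>auto simp: R_def\<close>)
    then show ?case by (simp add: m_def R_def)
  next
    case (Suc j)
    let ?R = "R (Suc j)"
    have above: "0 \<le> z $ k + \<psi> ?R" if "z \<in> \<Omega> \<inter> ball 0 ?R" for z
      by (rule exterior_Q_imp_above_half_space[OF assms(9,5,6) R(2) that])
    have "u x \<le> (m j + 4 * B * (m j * \<psi> (R j)) / ?R) * (x $ k + \<psi> ?R)"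
    proof (rule improve)
      show "u z \<le> m j * (z $ k + \<psi> ?R) + m j * \<psi> (R j)" if "z \<in> \<Omega> \<inter> ball 0 ?R" for z
      proof -
        have "0 \<le> \<psi> ?R" using \<delta>[of "Suc j"] R(1)[of "Suc j"] by simp
        then have "0 \<le> m j * \<psi> ?R" using m_nonneg by simp
        then show ?thesis using Suc.IH[OF that] by (simp add: algebra_simps)
      qed
      show "0 \<le> m j * \<psi> (R j)" using m_nonneg \<delta>[of j] R(1)[of j] by simp
      show "x \<in> \<Omega> \<inter> ball 0 (?R / 2)" using Suc.prems R(3)[of "Suc j"] by simp
      show "u z = 0" if "z \<in> frontier \<Omega> \<inter> ball 0 ?R" for z
        using that R(2)[of "Suc j"] by (intro assms(15)) auto
    qed (use above R(1) m_nonneg in auto)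
    also have "m j + 4 * B * (m j * \<psi> (R j)) / ?R = m (Suc j)"
      unfolding R(3) \<delta>(2) using R(1)[of j] by (simp add: m_def algebra_simps)
    finally show ?case .
  qed
  define C where "C = M * (1 + 4 * S) + 2 * K / r0"
  have "0 \<le> M" using m_nonneg[of 0] m_le[of 0] by linarith
  have "u x / norm x \<le> C" if x: "x \<in> \<Omega>" "norm x < r0" for x
  proof -
    have "0 \<notin> \<Omega>" using assms(1,3) by (auto simp: frontier_def interior_open)
    then have nx: "0 < norm x" using x(1) by auto
    have "u x \<le> C * norm x"
    proof (cases "norm x < r0 / 2")
      case False
      then have "K * r0 \<le> K * (2 * norm x)" using K(1) by (intro mult_left_mono) auto
      then have "K \<le> 2 * K / r0 * norm x" using \<open>0 < r0\<close> by (simp add: field_simps)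
      also have "\<dots> \<le> C * norm x"
        using \<open>0 \<le> M\<close> \<open>0 \<le> S\<close> nx by (intro mult_right_mono) (auto simp: C_def)
      finally show ?thesis using uK[OF x(1)] by simp
    next
      case True
      obtain n where "(1 / 2) ^ n < norm x / r0"
        using real_arch_pow_inv[of "norm x / r0" "1 / 2"] nx \<open>0 < r0\<close> by auto
      then have "R n \<le> norm x"
        using \<open>0 < r0\<close> by (simp add: R_def field_simps power_one_over)
      then have ex: "R (Suc n) \<le> norm x" using R(1)[of n] R(3)[of n] by simp
      \<comment> \<open>The estimate at scale \<open>j\<close> is valid in \<open>B(R\<^sub>j\<^sub>+\<^sub>1)\<close>, so the scale of \<open>x\<close> is the one with
        \<open>R\<^sub>j\<^sub>+\<^sub>2 \<le> |x| < R\<^sub>j\<^sub>+\<^sub>1\<close>.\<close>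
      define l where "l = (LEAST l. R (Suc l) \<le> norm x)"
      have l: "R (Suc l) \<le> norm x" unfolding l_def using ex by (rule LeastI)
      have "l \<noteq> 0" using l True by (cases l) (auto simp: R_def)
      then obtain j where j: "l = Suc j" by (cases l) auto
      have "norm x < R (Suc j)" using not_less_Least[of j "\<lambda>l. R (Suc l) \<le> norm x"] j l_def by auto
      then have "u x \<le> m j * (x $ k + \<psi> (R j))" using x(1) by (intro scale) auto
      also have "\<dots> \<le> m j * (norm x + S * (4 * norm x))"
      proof (intro mult_left_mono add_mono m_nonneg)
        show "x $ k \<le> norm x" using component_le_norm_cart[of x k] by linarith
        have "R j \<le> 4 * norm x" using l j R(3)[of j] R(3)[of "Suc j"] by simp
        then show "\<psi> (R j) \<le> S * (4 * norm x)"
          unfolding \<delta>(2) using \<delta>_le[of j] R(1)[of j] \<open>0 \<le> S\<close> by (intro mult_mono) auto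
      qed
      also have "\<dots> \<le> M * (norm x + S * (4 * norm x))"
        using m_le \<open>0 \<le> S\<close> nx by (intro mult_right_mono) auto
      also have "\<dots> = M * (1 + 4 * S) * norm x" by (simp add: algebra_simps)
      also have "\<dots> \<le> C * norm x"
        using K(1) \<open>0 < r0\<close> nx by (intro mult_right_mono) (auto simp: C_def)
      finally show ?thesis .
    qed
    then show ?thesis using nx by (simp add: field_simps)
  qed
  then have "(SUP x \<in> \<Omega> \<inter> ball 0 r0. ereal (u x / norm x)) \<le> ereal C"
    by (intro SUP_least) auto
  then show ?thesis by (rule order_le_less_trans) simp
qed

end
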